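(* Let $(f_i)_{i\in\mathcal V}$ be functions $f_i:\mathbb R^d\to\mathbb R$, each convex and $G$-Lipschitz with respect to the Euclidean norm ($G>0$), and let $\mathcal X\subset\mathbb R^d$ be a nonempty closed convex set. Let $T\ge 1$ be an integer, and consider the DAERON algorithm (defined in the context) run on an open network with finite nonempty active sets $\mathcal A_t\subset\mathcal V$, $t=1,2,\dots$, with starting point $x_1$. Assume that its delays are bounded by an integer $\tau\ge 0$: for all times $t,s\ge1$ with $t>s+\tau$, all $i\in\mathcal A_t$ and all $j\in\mathcal A_s$, one has $(j,s)\in\mathcal S_{i,t}$. Let $$n_t=\operatorname{card}(\mathcal A_t),\qquad \bar n_{\mathrm{rms}}=\sqrt{\frac1T\sum_{t=1}^T n_t^2},\qquad \bar n=\frac1T\sum_{t=1}^T n_t .$$ Let $u^\star\in\mathcal X$ be a minimizer over $\mathcal X$ of $u\mapsto \sum_{t=1}^T\sum_{i\in\mathcal A_t} f_i(u)$, and put $R=\|u^\star-x_1\|$, assumed positive. Let $R_0>0$ and suppose that the algorithm uses the constant learning rate $$\eta_{i,t}\equiv\eta=\frac{R_0}{\bar n_{\mathrm{rms}}\,G\sqrt{(3\tau+1)T}} .$$ Then, for every choice of reference agents $i_t\in\mathcal A_t$ $(1\le t\le T)$, the running loss $\mathrm{Loss}(T)$ with reference points $x_t^{\mathrm{ref}}=x_{i_t,t}$ (defined in the context) satisfies $$\mathrm{Loss}(T)\;\le\;\frac{\bar n_{\mathrm{rms}}}{\bar n}\cdot\frac{2\,C\,R\,G\sqrt{3\tau+1}}{\sqrt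 T},\qquad\text{where } C=\max\!\left(\frac{R}{2R_0},\frac{R_0}{R}\right).$$
   Context: Open network. $\mathcal V$ is a (possibly infinite) set of agents; agent $i$ has an individual cost function $f_i:\mathbb R^d\to\mathbb R$. At each time $t=1,2,\dots$ only a finite subset $\mathcal A_t\subset\mathcal V$ of agents is active; agents may join and leave over time. $\|\cdot\|$ is the Euclidean norm and $\Pi_{\mathcal X}(y)=\arg\min_{x\in\mathcal X}\|x-y\|$ is the projection onto the common constraint set $\mathcal X$. DAERON (Dual AvERaging for Open Networks). All agents share a common starting point $x_1$. At time $t$, each active agent $i\in\mathcal A_t$ holds a finite set $\mathcal S_{i,t}$ of pairs $(j,s)$ indexing the subgradients $g_{j,s}$ that it has received or computed by time $t$; every such pair satisfies $1\le s\le t-1$ and $j\in\mathcal A_s$. These sets are generated as follows. Agents active at time $1$ start with $\mathcal S_{i,1}=\emptyset$. At each time $t$, each agent $i\in\mathcal A_t$: (1) computes its local variable $$x_{i,t}=\Pi_{\mathcal X}\Big(x_1-\eta_{i,t}\sum_{(j,s)\in\mathcal S_{i,t}} g_{j,s}\Big),$$ where $\eta_{i,t}>0$ is the learning rate; (2) computes an (arbitrary) subgradient $g_{i,t}\in\partial f_i(x_{i,t})$; (3) exchanges subgradients with other active agents, receiving the subgradients indexed by some finite (arbitrary) set $\mathcal G_{i,t}\subset\{(j,s): 1\le s\le t,\ j\in\mathcal A_s\}$; (4) if it remains active, sets $\mathcal S_{i,t+1}=\mathcal S_{i,t}\cup\mathcal G_{i,t}\cup\{(i,t)\}$. An agent $i$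 that joins at time $t\ge2$ (i.e. $i\in\mathcal A_t\setminus\mathcal A_{t-1}$) is initialized with $\mathcal S_{i,t}=\mathcal S_{j,t}$ for some agent $j\in\mathcal A_{t-1}\cap\mathcal A_t$ (this intersection is assumed nonempty). Running loss. Given reference points $x_t^{\mathrm{ref}}$, $1\le t\le T$, and $N_T=\sum_{t=1}^T n_t$ with $n_t=\operatorname{card}(\mathcal A_t)$, $$\mathrm{Loss}(T)=\frac1{N_T}\left(\sum_{t=1}^T\sum_{i\in\mathcal A_t} f_i(x_t^{\mathrm{ref}})-\min_{u\in\mathcal X}\sum_{t=1}^T\sum_{i\in\mathcal A_t} f_i(u)\right).$$ Here $x_t^{\mathrm{ref}}=x_{i_t,t}$, where $i_t\in\mathcal A_t$ is a reference agent chosen arbitrarily at each time. The minimum is assumed to be attained, and $u^\star$ denotes a minimizer. *)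

theory Defs
  imports "HOL-Analysis.Analysis"
begin

definition subdifferential :: "('a::real_inner \<Rightarrow> real) \<Rightarrow> 'a \<Rightarrow> 'a set" where
  "subdifferential f x = {g. \<forall>y. f y \<ge> f x + g \<bullet> (y - x)}"

text \<open>Times are the natural numbers \<open>t \<ge> 1\<close>; nothing is required at time \<open>0\<close>.\<close>

locale open_network =
  fixes V :: "'v set"
    and A :: "nat \<Rightarrow> 'v set"
  assumes active_subset: "t \<ge> 1 \<Longrightarrow> A t \<subseteq> V"
    and active_finite: "t \<ge> 1 \<Longrightarrow> finite (A t)"
    and active_nonempty: "t \<ge> 1 \<Longrightarrow> A t \<noteq> {}"

text \<open>
  A run of dual averaging on an open network. \<open>S i t\<close> indexes the subgradients held by agent
  \<open>i\<close> when it computes \<open>x i t\<close>, and \<open>M i t\<close> those it receives at time \<open>t\<close>. The pairs are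
  \<open>(agent, time)\<close>. All families are unconstrained at pairs with \<open>i \<notin> A t\<close>.
  The exchanged sets \<open>M\<close>, the subgradients \<open>g\<close> and the choice of the agent from which a
  joining agent copies its set are arbitrary, hence a run is described by a predicate.
\<close>

locale daeron = open_network V A
  for V :: "'v set" and A :: "nat \<Rightarrow> 'v set" +
  fixes f :: "'v \<Rightarrow> 'a::euclidean_space \<Rightarrow> real"
    and X :: "'a set"
    and x1 :: 'a
    and \<eta> :: "'v \<Rightarrow> nat \<Rightarrow> real"
    and S :: "'v \<Rightarrow> nat \<Rightarrow> ('v \<times> nat) set"
    and M :: "'v \<Rightarrow> nat \<Rightarrow> ('v \<times> nat) set"
    and x :: "'v \<Rightarrow> nat \<Rightarrow> 'a"
    and g :: "'v \<Rightarrow> nat \<Rightarrow> 'a"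
  assumes rate_pos: "t \<ge> 1 \<Longrightarrow> i \<in> A t \<Longrightarrow> \<eta> i t > 0"
    and init: "i \<in> A 1 \<Longrightarrow> S i 1 = {}"
    and local_variable: "t \<ge> 1 \<Longrightarrow> i \<in> A t \<Longrightarrow>
      x i t = closest_point X (x1 - \<eta> i t *\<^sub>R (\<Sum>(j, s)\<in>S i t. g j s))"
    and subgradient: "t \<ge> 1 \<Longrightarrow> i \<in> A t \<Longrightarrow> g i t \<in> subdifferential (f i) (x i t)"
    and received: "t \<ge> 1 \<Longrightarrow> i \<in> A t \<Longrightarrow>
      finite (M i t) \<and> M i t \<subseteq> {(j, s). 1 \<le> s \<and> s \<le> t \<and> j \<in> A s}"
    and stay: "t \<ge> 1 \<Longrightarrow> i \<in> A t \<Longrightarrow> i \<in> A (t + 1) \<Longrightarrow>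
      S i (t + 1) = S i t \<union> M i t \<union> {(i, t)}"
    and join: "t \<ge> 2 \<Longrightarrow> i \<in> A t - A (t - 1) \<Longrightarrow> \<exists>j \<in> A (t - 1) \<inter> A t. S i t = S j t"
begin

lemma held_finite_past:
  assumes "t \<ge> 1" "i \<in> A t"
  shows "finite (S i t) \<and> S i t \<subseteq> {(j, s). 1 \<le> s \<and> s \<le> t - 1 \<and> j \<in> A s}"
  using assms
proof (induction t arbitrary: i rule: dec_induct)
  case base
  then show ?case using init by simp
next
  case (step t)
  have stayed: "finite (S k (Suc t)) \<and>
      S k (Suc t) \<subseteq> {(j, s). 1 \<le> s \<and> s \<le> Suc t - 1 \<and> j \<in> A s}"
    if "k \<in> A t" "k \<in> A (Suc t)" for k
    using step.IH[OF that(1)] received[OF step.hyps(1) that(1)] stay[OF step.hyps(1)] that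
      step.hyps(1) by fastforce
  show ?case
  proof (cases "i \<in> A t")
    case True
    then show ?thesis using stayed step.prems by blast
  next
    case False
    then obtain k where "k \<in> A t" "k \<in> A (Suc t)" "S i (Suc t) = S k (Suc t)"
      using join[of "Suc t" i] step.prems step.hyps(1) by auto
    then show ?thesis using stayed by simp
  qed
qed

lemma consecutive_active_meet:
  assumes "t \<ge> 2"
  shows "A (t - 1) \<inter> A t \<noteq> {}"
  using join[OF assms] active_nonempty[of t] assms by fastforce

end

definition delays_bounded ::
  "(nat \<Rightarrow> 'v set) \<Rightarrow> ('v \<Rightarrow> nat \<Rightarrow> ('v \<times> nat) set) \<Rightarrow> nat \<Rightarrow> bool" where
  "delays_bounded A S \<tau> \<longleftrightarrow>
    (\<forall>t\<ge>1. \<forall>s\<ge>1. t > s + \<tau> \<longrightarrow> (\<forall>i\<in>A t. \<forall>j\<in>A s. (j, s) \<in> S i t))"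

definition n_mean :: "(nat \<Rightarrow> 'v set) \<Rightarrow> nat \<Rightarrow> real" where
  "n_mean A T = 1 / real T * (\<Sum>t=1..T. real (card (A t)))"

definition n_rms :: "(nat \<Rightarrow> 'v set) \<Rightarrow> nat \<Rightarrow> real" where
  "n_rms A T = sqrt (1 / real T * (\<Sum>t=1..T. (real (card (A t)))\<^sup>2))"

definition total_cost :: "('v \<Rightarrow> 'a \<Rightarrow> real) \<Rightarrow> (nat \<Rightarrow> 'v set) \<Rightarrow> nat \<Rightarrow> 'a \<Rightarrow> real" where
  "total_cost f A T u = (\<Sum>t=1..T. \<Sum>i\<in>A t. f i u)"

text \<open>The infimum is the minimum whenever the latter is attained, see below.\<close>

definition running_loss ::
  "('v \<Rightarrow> 'a \<Rightarrow> real) \<Rightarrow> (nat \<Rightarrow> 'v set) \<Rightarrow> 'a set \<Rightarrow> (nat \<Rightarrow> 'a) \<Rightarrow> nat \<Rightarrow> real" where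
  "running_loss f A X xref T =
    1 / real (\<Sum>t=1..T. card (A t)) *
      ((\<Sum>t=1..T. \<Sum>i\<in>A t. f i (xref t)) - (INF u\<in>X. total_cost f A T u))"

lemma INF_total_cost_minimizer:
  assumes "is_arg_min (total_cost f A T) (\<lambda>u. u \<in> X) v"
  shows "(INF u\<in>X. total_cost f A T u) = total_cost f A T v"
  using assms by (intro cInf_eq_minimum) (auto simp: is_arg_min_def not_less)

end

theory Submission
  imports Defs
begin

text \<open>
  The proof compares every agent with an ideal agent that knows all past subgradients. Write
  \<open>h\<^sub>s\<close> for the sum of the subgradients computed at time \<open>s\<close> and
  \<open>y\<^sub>t = \<Pi>\<^sub>X (x\<^sub>1 - \<eta> (h\<^sub>1 + \<dots> + h\<^sub>t\<^sub>-\<^sub>1))\<close> for the iterate of the ideal agent; this is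
  \<open>dual_average\<close> below.

  \<^item> The ideal agent runs plain dual averaging, whose regret on the linear losses \<open>h\<^sub>t\<close> is at most
    \<open>R\<^sup>2 / (2 \<eta>) + \<eta> \<Sum> \<parallel>h\<^sub>t\<parallel>\<^sup>2\<close>, where \<open>\<parallel>h\<^sub>t\<parallel> \<le> n\<^sub>t G\<close> (\<open>dual_averaging_regret\<close>): the point
    \<open>y\<^sub>t\<^sub>+\<^sub>1\<close> minimizes the regularized loss accumulated up to time \<open>t\<close>, so playing \<open>y\<^sub>t\<^sub>+\<^sub>1\<close> at time
    \<open>t\<close> costs only the regularizer, and \<open>y\<^sub>t\<close> is within \<open>\<eta> \<parallel>h\<^sub>t\<parallel>\<close> of \<open>y\<^sub>t\<^sub>+\<^sub>1\<close>.

  \<^item> At time \<open>t\<close> an agent lacks only subgradients of the \<open>\<tau>\<close> preceding times. As projections do not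
    increase distances, its variable lies within \<open>\<eta> G\<close> times the sum of the \<open>n\<^sub>s\<close> over these times of
    \<open>y\<^sub>t\<close> (\<open>dist_full_information\<close>).

  \<^item> Passing from the loss of agent \<open>i\<close> at the reference point to \<open>\<langle>g\<^sub>i\<^sub>,\<^sub>t, y\<^sub>t - u\<rangle>\<close> uses such a
    distance three times, each at the price of a factor \<open>G\<close>. Summed over agents and times, the
    products \<open>n\<^sub>t n\<^sub>s\<close> with \<open>t - \<tau> \<le> s < t\<close> contribute at most \<open>\<tau> \<Sum> n\<^sub>t\<^sup>2\<close>
    (\<open>sum_delay_window_products\<close>).

  Together the total excess cost is at most \<open>R\<^sup>2 / (2 \<eta>) + \<eta> G\<^sup>2 (3 \<tau> + 1) \<Sum> n\<^sub>t\<^sup>2\<close>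
  (\<open>total_cost_excess\<close>). The prescribed \<open>\<eta>\<close> balances the two terms up to the mismatch between
  \<open>R\<^sub>0\<close> and \<open>R\<close>, and each of them is at most \<open>C R G\<close> times the square root of
  \<open>(3 \<tau> + 1) \<Sum> n\<^sub>t\<^sup>2\<close>.
\<close>

section \<open>Dual averaging with full information\<close>

definition dual_average ::
  "'a::euclidean_space set \<Rightarrow> 'a \<Rightarrow> real \<Rightarrow> (nat \<Rightarrow> 'a) \<Rightarrow> nat \<Rightarrow> 'a" where
  "dual_average X x1 \<eta> h t = closest_point X (x1 - \<eta> *\<^sub>R (\<Sum>s\<in>{1..<t}. h s))"

text \<open>
  Completing the square turns the projection of \<open>x1 - \<eta> *\<^sub>R v\<close> into the minimization of a
  linear loss with a quadratic regularizer.
\<close>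

lemma closest_point_minimizes_regularized_loss:
  fixes X :: "'a::euclidean_space set" and u v x1 :: 'a and \<eta> :: real
  assumes "closed X" "u \<in> X"
  defines "p \<equiv> closest_point X (x1 - \<eta> *\<^sub>R v)"
  shows "\<eta> * (v \<bullet> p) + (norm (p - x1))\<^sup>2 / 2 \<le> \<eta> * (v \<bullet> u) + (norm (u - x1))\<^sup>2 / 2"
proof -
  have "norm (p - (x1 - \<eta> *\<^sub>R v)) \<le> norm (u - (x1 - \<eta> *\<^sub>R v))"
    using closest_point_le[OF assms(1,2), of "x1 - \<eta> *\<^sub>R v"]
    by (simp add: p_def dist_norm norm_minus_commute)
  then have le: "(norm (p - (x1 - \<eta> *\<^sub>R v)))\<^sup>2 \<le> (norm (u - (x1 - \<eta> *\<^sub>R v)))\<^sup>2"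
    by (simp add: power_mono)
  have square: "(norm (w - (x1 - \<eta> *\<^sub>R v)))\<^sup>2
      = (norm (w - x1))\<^sup>2 + 2 * (\<eta> * (v \<bullet> w)) - 2 * (\<eta> * (v \<bullet> x1)) + \<eta>\<^sup>2 * (v \<bullet> v)" for w
    unfolding power2_norm_eq_inner
    by (simp add: inner_diff_left inner_diff_right inner_commute power2_eq_square algebra_simps)
  show ?thesis using le unfolding square by linarith
qed

text \<open>
  The one-step-ahead iterates pay only the regularizer: by induction the accumulated loss of the
  leaders is at most the regularized loss of any fixed point, in particular of the next leader,
  which in turn minimizes the regularized loss one step later.
\<close>

lemma leader_regret:
  fixes X :: "'a::euclidean_space set"
  assumes "closed X" "X \<noteq> {}" "u \<in> X"
  shows "(\<Sum>t=1..T. \<eta> * (h t \<bullet> dual_average X x1 \<eta> h (Suc t)))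
    \<le> \<eta> * ((\<Sum>t=1..T. h t) \<bullet> u) + (norm (u - x1))\<^sup>2 / 2"
  using assms(3)
proof (induction T arbitrary: u)
  case 0
  then show ?case by simp
next
  case (Suc T)
  let ?p = "dual_average X x1 \<eta> h (Suc (Suc T))"
  have "?p \<in> X"
    using assms by (simp add: dual_average_def closest_point_in_set)
  from Suc.IH[OF this]
  have "(\<Sum>t=1..Suc T. \<eta> * (h t \<bullet> dual_average X x1 \<eta> h (Suc t)))
      \<le> \<eta> * ((\<Sum>t=1..Suc T. h t) \<bullet> ?p) + (norm (?p - x1))\<^sup>2 / 2"
    by (simp add: inner_add_left algebra_simps)
  also have "\<dots> \<le> \<eta> * ((\<Sum>t=1..Suc T. h t) \<bullet> u) + (norm (u - x1))\<^sup>2 / 2"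
    using closest_point_minimizes_regularized_loss[OF assms(1) Suc.prems]
    by (simp add: dual_average_def atLeastLessThanSuc_atLeastAtMost del: sum.cl_ivl_Suc)
  finally show ?case .
qed

lemma dual_average_step:
  fixes X :: "'a::euclidean_space set"
  assumes "closed X" "convex X" "X \<noteq> {}" "\<eta> \<ge> 0" "t \<ge> 1"
  shows "norm (dual_average X x1 \<eta> h t - dual_average X x1 \<eta> h (Suc t)) \<le> \<eta> * norm (h t)"
proof -
  have "dist (dual_average X x1 \<eta> h t) (dual_average X x1 \<eta> h (Suc t))
      \<le> dist (x1 - \<eta> *\<^sub>R (\<Sum>s\<in>{1..<t}. h s)) (x1 - \<eta> *\<^sub>R (\<Sum>s\<in>{1..<Suc t}. h s))"
    unfolding dual_average_def using assms by (intro closest_point_lipschitz) auto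
  also have "\<dots> = \<eta> * norm (h t)"
    using assms by (simp add: dist_norm algebra_simps)
  finally show ?thesis by (simp add: dist_norm)
qed

lemma dual_averaging_regret:
  fixes X :: "'a::euclidean_space set"
  assumes "closed X" "convex X" "X \<noteq> {}" "\<eta> > 0" "u \<in> X"
  shows "(\<Sum>t=1..T. h t \<bullet> (dual_average X x1 \<eta> h t - u))
    \<le> (norm (u - x1))\<^sup>2 / (2 * \<eta>) + \<eta> * (\<Sum>t=1..T. (norm (h t))\<^sup>2)"
proof -
  let ?y = "dual_average X x1 \<eta> h"
  have "\<eta> * (\<Sum>t=1..T. h t \<bullet> (?y (Suc t) - u)) \<le> (norm (u - x1))\<^sup>2 / 2"
    using leader_regret[OF assms(1,3,5), of \<eta> h x1 T]
    by (simp add: inner_diff_right sum_subtractf right_diff_distrib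
        flip: inner_sum_left sum_distrib_left)
  then have leader: "(\<Sum>t=1..T. h t \<bullet> (?y (Suc t) - u)) \<le> (norm (u - x1))\<^sup>2 / (2 * \<eta>)"
    using \<open>\<eta> > 0\<close> by (simp add: field_simps)
  have "(\<Sum>t=1..T. h t \<bullet> (?y t - ?y (Suc t))) \<le> (\<Sum>t=1..T. \<eta> * (norm (h t))\<^sup>2)"
  proof (rule sum_mono)
    fix t assume "t \<in> {1..T}"
    have "h t \<bullet> (?y t - ?y (Suc t)) \<le> norm (h t) * norm (?y t - ?y (Suc t))"
      by (rule norm_cauchy_schwarz)
    also have "\<dots> \<le> norm (h t) * (\<eta> * norm (h t))"
      using assms \<open>t \<in> {1..T}\<close> by (intro mult_left_mono dual_average_step) auto
    finally show "h t \<bullet> (?y t - ?y (Suc t)) \<le> \<eta> * (norm (h t))\<^sup>2"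
      by (simp add: power2_eq_square algebra_simps)
  qed
  moreover have "(\<Sum>t=1..T. h t \<bullet> (?y t - u))
      = (\<Sum>t=1..T. h t \<bullet> (?y t - ?y (Suc t))) + (\<Sum>t=1..T. h t \<bullet> (?y (Suc t) - u))"
    by (simp add: sum.distrib[symmetric] inner_diff_right)
  ultimately show ?thesis
    using leader by (simp add: sum_distrib_left)
qed

section \<open>Delay windows\<close>

definition delay_window :: "nat \<Rightarrow> nat \<Rightarrow> nat set" where
  "delay_window \<tau> t = {s \<in> {1..<t}. t \<le> s + \<tau>}"

text \<open>
  By \<open>n\<^sub>t n\<^sub>s \<le> (n\<^sub>t\<^sup>2 + n\<^sub>s\<^sup>2) / 2\<close>, it is enough that a time has at most \<open>\<tau>\<close> times in its
  window and lies in the windows of at most \<open>\<tau>\<close> times.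
\<close>

lemma sum_delay_window_products:
  fixes n :: "nat \<Rightarrow> real"
  shows "(\<Sum>t=1..T. n t * (\<Sum>s\<in>delay_window \<tau> t. n s)) \<le> real \<tau> * (\<Sum>t=1..T. (n t)\<^sup>2)"
proof -
  have card_window: "card (delay_window \<tau> t) \<le> \<tau>" for t
  proof -
    have "card (delay_window \<tau> t) \<le> card {t - \<tau>..<t}"
      by (intro card_mono) (auto simp: delay_window_def)
    then show ?thesis by simp
  qed
  have card_dual: "card {t \<in> {1..T}. s < t \<and> t \<le> s + \<tau>} \<le> \<tau>" for s
  proof -
    have "card {t \<in> {1..T}. s < t \<and> t \<le> s + \<tau>} \<le> card {s<..s + \<tau>}"
      by (intro card_mono) auto
    then show ?thesis by simp
  qed
  have own: "(\<Sum>t=1..T. \<Sum>s\<in>delay_window \<tau> t. (n t)\<^sup>2) \<le> real \<tau> * (\<Sum>t=1..T. (n t)\<^sup>2)"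
    using card_window by (auto simp: sum_distrib_left intro!: sum_mono mult_right_mono)
  have "(\<Sum>t=1..T. \<Sum>s\<in>delay_window \<tau> t. (n s)\<^sup>2)
      = (\<Sum>t=1..T. \<Sum>s | s \<in> {1..T} \<and> (s < t \<and> t \<le> s + \<tau>). (n s)\<^sup>2)"
    by (intro sum.cong refl) (auto simp: delay_window_def)
  also have "\<dots> = (\<Sum>s=1..T. \<Sum>t | t \<in> {1..T} \<and> (s < t \<and> t \<le> s + \<tau>). (n s)\<^sup>2)"
    by (rule sum.swap_restrict) auto
  also have "\<dots> \<le> real \<tau> * (\<Sum>t=1..T. (n t)\<^sup>2)"
    unfolding sum_distrib_left using card_dual
    by (intro sum_mono) (simp add: mult_right_mono)
  finally have other:
    "(\<Sum>t=1..T. \<Sum>s\<in>delay_window \<tau> t. (n s)\<^sup>2) \<le> real \<tau> * (\<Sum>t=1..T. (n t)\<^sup>2)" .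
  have "2 * (\<Sum>t=1..T. n t * (\<Sum>s\<in>delay_window \<tau> t. n s))
      = (\<Sum>t=1..T. \<Sum>s\<in>delay_window \<tau> t. 2 * n t * n s)"
    by (simp add: sum_distrib_left mult.assoc)
  also have "\<dots> \<le> (\<Sum>t=1..T. \<Sum>s\<in>delay_window \<tau> t. (n t)\<^sup>2 + (n s)\<^sup>2)"
    by (intro sum_mono sum_squares_bound)
  also have "\<dots> \<le> 2 * (real \<tau> * (\<Sum>t=1..T. (n t)\<^sup>2))"
    using own other unfolding sum.distrib by linarith
  finally show ?thesis by simp
qed

section \<open>Comparison of the agents with the full-information iterate\<close>

lemma lipschitz_subgradient_norm_le:
  fixes f :: "'a::euclidean_space \<Rightarrow> real"
  assumes "G-lipschitz_on UNIV f" "v \<in> subdifferential f z"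
  shows "norm v \<le> G"
proof -
  have "norm v * norm v \<le> f (z + v) - f z"
    using assms(2) by (auto simp: subdifferential_def dest: spec[of _ "z + v"]
        simp flip: power2_norm_eq_inner power2_eq_square)
  also have "\<dots> \<le> G * norm v"
    using lipschitz_onD[OF assms(1), of "z + v" z] by (simp add: dist_norm)
  finally have "norm v * norm v \<le> G * norm v" .
  moreover have "G \<ge> 0"
    using assms(1) by (rule lipschitz_on_nonneg)
  ultimately show ?thesis
    by (cases "v = 0") auto
qed

text \<open>
  The index pairs carry the agent first, whereas sums over a dependent product carry the time
  first.
\<close>

lemma sum_agent_time_pairs:
  assumes "finite I" "\<And>s. s \<in> I \<Longrightarrow> finite (A s)"
  shows "(\<Sum>(j, s)\<in>{(j, s). s \<in> I \<and> j \<in> A s}. h j s) = (\<Sum>s\<in>I. \<Sum>j\<in>A s. h j s)"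
proof -
  have "(\<Sum>s\<in>I. \<Sum>j\<in>A s. h j s) = (\<Sum>(s, j)\<in>(SIGMA s:I. A s). h j s)"
    using assms by (simp add: sum.Sigma)
  also have "\<dots> = (\<Sum>(j, s)\<in>{(j, s). s \<in> I \<and> j \<in> A s}. h j s)"
    by (rule sum.reindex_bij_witness[of _ prod.swap prod.swap]) auto
  finally show ?thesis ..
qed

lemma finite_agent_time_pairs:
  assumes "finite I" "\<And>s. s \<in> I \<Longrightarrow> finite (A s)"
  shows "finite {(j, s). s \<in> I \<and> j \<in> A s}"
proof (rule finite_subset)
  show "{(j, s). s \<in> I \<and> j \<in> A s} \<subseteq> prod.swap ` (SIGMA s:I. A s)"
    by force
  show "finite (prod.swap ` (SIGMA s:I. A s))"
    using assms by blast
qed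

context daeron
begin

text \<open>
  The pairs of the past that an agent does not hold all have their time in the delay window, and
  each missing subgradient moves the point to be projected by at most \<open>\<eta> G\<close>.
\<close>

lemma dist_full_information:
  assumes X: "closed X" "convex X" "X \<noteq> {}"
    and delay: "delays_bounded A S \<tau>"
    and bound: "\<And>s j. s \<ge> 1 \<Longrightarrow> j \<in> A s \<Longrightarrow> norm (g j s) \<le> G"
    and t: "t \<ge> 1" "i \<in> A t"
  shows "norm (x i t - dual_average X x1 (\<eta> i t) (\<lambda>s. \<Sum>j\<in>A s. g j s) t)
    \<le> \<eta> i t * (G * (\<Sum>s\<in>delay_window \<tau> t. real (card (A s))))"
proof -
  let ?P = "{(j, s). s \<in> {1..<t} \<and> j \<in> A s}"
  let ?W = "{(j, s). s \<in> delay_window \<tau> t \<and> j \<in> A s}"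
  have finP: "finite ?P"
    by (rule finite_agent_time_pairs) (auto intro: active_finite)
  have finW: "finite ?W"
    by (rule finite_agent_time_pairs) (auto simp: delay_window_def intro: active_finite)
  have "S i t \<subseteq> ?P"
    using held_finite_past[OF t] by force
  have missing: "?P - S i t \<subseteq> ?W"
  proof -
    have "s \<in> delay_window \<tau> t" if "1 \<le> s" "s < t" "j \<in> A s" "(j, s) \<notin> S i t" for j s
    proof -
      have "\<not> s + \<tau> < t"
        using delay t that unfolding delays_bounded_def by blast
      then show ?thesis
        using that by (simp add: delay_window_def)
    qed
    then show ?thesis by auto
  qed
  have G: "G \<ge> 0"
    using bound[OF t] norm_ge_zero order_trans by blast
  have "(\<Sum>s\<in>{1..<t}. \<Sum>j\<in>A s. g j s) = (\<Sum>(j, s)\<in>?P. g j s)"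
    by (rule sum_agent_time_pairs[symmetric]) (auto intro: active_finite)
  then have "norm ((\<Sum>s\<in>{1..<t}. \<Sum>j\<in>A s. g j s) - (\<Sum>(j, s)\<in>S i t. g j s))
      = norm (\<Sum>(j, s)\<in>?P - S i t. g j s)"
    using sum_diff[OF finP \<open>S i t \<subseteq> ?P\<close>, of "\<lambda>(j, s). g j s"] by simp
  also have "\<dots> \<le> (\<Sum>(j, s)\<in>?P - S i t. G)"
    using bound by (intro sum_norm_le) auto
  also have "\<dots> \<le> (\<Sum>(j, s)\<in>?W. G)"
    using finW missing G by (intro sum_mono2) auto
  also have "\<dots> = G * (\<Sum>s\<in>delay_window \<tau> t. real (card (A s)))"
    by (subst sum_agent_time_pairs)
      (auto simp: delay_window_def sum_distrib_left mult.commute intro: active_finite)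
  finally have diff: "norm ((\<Sum>s\<in>{1..<t}. \<Sum>j\<in>A s. g j s) - (\<Sum>(j, s)\<in>S i t. g j s))
      \<le> G * (\<Sum>s\<in>delay_window \<tau> t. real (card (A s)))" .
  have "dist (x i t) (dual_average X x1 (\<eta> i t) (\<lambda>s. \<Sum>j\<in>A s. g j s) t)
      \<le> dist (x1 - \<eta> i t *\<^sub>R (\<Sum>(j, s)\<in>S i t. g j s))
          (x1 - \<eta> i t *\<^sub>R (\<Sum>s\<in>{1..<t}. \<Sum>j\<in>A s. g j s))"
    unfolding dual_average_def local_variable[OF t] using X by (intro closest_point_lipschitz)
  also have "\<dots> = \<eta> i t * norm ((\<Sum>s\<in>{1..<t}. \<Sum>j\<in>A s. g j s) - (\<Sum>(j, s)\<in>S i t. g j s))"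
    using rate_pos[OF t] by (simp add: dist_norm flip: scaleR_diff_right)
  also have "\<dots> \<le> \<eta> i t * (G * (\<Sum>s\<in>delay_window \<tau> t. real (card (A s))))"
    using diff rate_pos[OF t] by (simp add: mult_left_mono)
  finally show ?thesis by (simp add: dist_norm)
qed

text \<open>
  The detour from the reference point to the comparison point \<open>u\<close> goes through the
  full-information iterate \<open>y\<close>, then to the variable of agent \<open>i\<close>, where the subgradient was taken,
  and back to \<open>y\<close>; the three moves account for the factor \<open>3\<close>.
\<close>

lemma cost_excess_le:
  assumes lip: "G-lipschitz_on UNIV (f i)"
    and t: "t \<ge> 1" "i \<in> A t"
    and near: "norm (z - y) \<le> D" "norm (x i t - y) \<le> D"
  shows "f i z - f i u \<le> 3 * (G * D) + g i t \<bullet> (y - u)"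
proof -
  have G: "G \<ge> 0"
    using lip by (rule lipschitz_on_nonneg)
  have lip_le: "f i a - f i b \<le> G * norm (a - b)" for a b
    using lipschitz_onD[OF lip, of a b] by (simp add: dist_norm)
  have "norm (g i t) \<le> G"
    using lipschitz_subgradient_norm_le[OF lip subgradient[OF t]] .
  have "f i z - f i y \<le> G * D"
    using lip_le[of z y] mult_left_mono[OF near(1) G] by linarith
  moreover have "f i y - f i (x i t) \<le> G * D"
    using lip_le[of y "x i t"] mult_left_mono[OF near(2) G] by (simp add: norm_minus_commute)
  moreover have "f i (x i t) - f i u \<le> g i t \<bullet> (x i t - u)"
    using subgradient[OF t] by (auto simp: subdifferential_def inner_diff_right dest: spec[of _ u])
  moreover have "g i t \<bullet> (x i t - y) \<le> G * D"
    using norm_cauchy_schwarz[of "g i t" "x i t - y"]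
      mult_mono[OF \<open>norm (g i t) \<le> G\<close> near(2) G norm_ge_zero] by linarith
  ultimately show ?thesis
    by (simp add: inner_diff_right)
qed

lemma total_cost_excess:
  assumes lip: "\<And>i. i \<in> V \<Longrightarrow> G-lipschitz_on UNIV (f i)"
    and X: "closed X" "convex X" "X \<noteq> {}" "u \<in> X"
    and delay: "delays_bounded A S \<tau>"
    and rate: "\<And>t i. t \<ge> 1 \<Longrightarrow> i \<in> A t \<Longrightarrow> \<eta> i t = e"
    and ref: "\<And>t. 1 \<le> t \<Longrightarrow> t \<le> T \<Longrightarrow> ref t \<in> A t"
  shows "(\<Sum>t=1..T. \<Sum>i\<in>A t. f i (x (ref t) t)) - total_cost f A T u
    \<le> (norm (u - x1))\<^sup>2 / (2 * e)
      + e * G\<^sup>2 * (3 * real \<tau> + 1) * (\<Sum>t=1..T. (real (card (A t)))\<^sup>2)"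
proof -
  define h where "h s = (\<Sum>j\<in>A s. g j s)" for s
  define y where "y = dual_average X x1 e h"
  define n where "n t = real (card (A t))" for t
  define D where "D t = e * (G * (\<Sum>s\<in>delay_window \<tau> t. n s))" for t
  obtain i where "i \<in> A 1"
    using active_nonempty[of 1] by auto
  then have e: "e > 0"
    using rate_pos[of 1 i] rate[of 1 i] by simp
  have lip': "G-lipschitz_on UNIV (f i)" if "t \<ge> 1" "i \<in> A t" for i t
    using active_subset[OF that(1)] that(2) lip by blast
  have bound: "norm (g j s) \<le> G" if "s \<ge> 1" "j \<in> A s" for j s
    using lipschitz_subgradient_norm_le[OF lip'[OF that] subgradient[OF that]] .
  have near: "norm (x i t - y t) \<le> D t" if "t \<ge> 1" "i \<in> A t" for i t
    using dist_full_information[OF X(1-3) delay bound that] rate[OF that]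
    by (simp add: y_def h_def[abs_def] D_def n_def)
  have norm_h: "norm (h t) \<le> n t * G" if "t \<ge> 1" for t
    unfolding h_def n_def using bound[OF that] by (intro sum_norm_bound)
  have "(\<Sum>t=1..T. \<Sum>i\<in>A t. f i (x (ref t) t)) - total_cost f A T u
      = (\<Sum>t=1..T. \<Sum>i\<in>A t. f i (x (ref t) t) - f i u)"
    by (simp add: total_cost_def sum_subtractf)
  also have "\<dots> \<le> (\<Sum>t=1..T. \<Sum>i\<in>A t. 3 * (G * D t) + g i t \<bullet> (y t - u))"
    using ref near lip' by (intro sum_mono cost_excess_le) auto
  also have "\<dots> = 3 * e * G\<^sup>2 * (\<Sum>t=1..T. n t * (\<Sum>s\<in>delay_window \<tau> t. n s))
      + (\<Sum>t=1..T. h t \<bullet> (y t - u))"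
    by (simp add: sum.distrib D_def h_def n_def inner_sum_left sum_distrib_left power2_eq_square
        mult.assoc mult.left_commute)
  also have "\<dots> \<le> 3 * e * G\<^sup>2 * (real \<tau> * (\<Sum>t=1..T. (n t)\<^sup>2))
      + ((norm (u - x1))\<^sup>2 / (2 * e) + e * (\<Sum>t=1..T. (norm (h t))\<^sup>2))"
    unfolding y_def using e X
    by (intro add_mono mult_left_mono sum_delay_window_products dual_averaging_regret) auto
  also have "\<dots> \<le> 3 * e * G\<^sup>2 * (real \<tau> * (\<Sum>t=1..T. (n t)\<^sup>2))
      + ((norm (u - x1))\<^sup>2 / (2 * e) + e * (\<Sum>t=1..T. (n t * G)\<^sup>2))"
    using e norm_h by (intro add_left_mono mult_left_mono sum_mono power_mono) auto
  also have "\<dots> = (norm (u - x1))\<^sup>2 / (2 * e) + e * G\<^sup>2 * (3 * real \<tau> + 1) * (\<Sum>t=1..T. (n t)\<^sup>2)"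
    by (simp add: power_mult_distrib algebra_simps flip: sum_distrib_left sum_distrib_right)
  finally show ?thesis
    by (simp add: n_def)
qed

end

section \<open>The running loss\<close>

theorem theorem1:
  fixes V :: "'v set"
    and A :: "nat \<Rightarrow> 'v set"
    and f :: "'v \<Rightarrow> real ^ 'd \<Rightarrow> real"
    and X :: "(real ^ 'd) set"
    and x1 ustar :: "real ^ 'd"
    and G R R\<^sub>0 \<eta> C :: real
    and T \<tau> :: nat
    and S M :: "'v \<Rightarrow> nat \<Rightarrow> ('v \<times> nat) set"
    and x g :: "'v \<Rightarrow> nat \<Rightarrow> real ^ 'd"
    and ref :: "nat \<Rightarrow> 'v"
  assumes "G > 0"
    and "\<And>i. i \<in> V \<Longrightarrow> convex_on UNIV (f i)"
    and "\<And>i. i \<in> V \<Longrightarrow> G-lipschitz_on UNIV (f i)"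
    and "X \<noteq> {}" and "closed X" and "convex X"
    and "T \<ge> 1"
    and "daeron V A f X x1 (\<lambda>i t. \<eta>) S M x g"
    and "delays_bounded A S \<tau>"
    and "is_arg_min (total_cost f A T) (\<lambda>u. u \<in> X) ustar"
    and "R = norm (ustar - x1)" and "R > 0"
    and "R\<^sub>0 > 0"
    and "\<eta> = R\<^sub>0 / (n_rms A T * G * sqrt ((3 * real \<tau> + 1) * real T))"
    and "C = max (R / (2 * R\<^sub>0)) (R\<^sub>0 / R)"
    and "\<And>t. 1 \<le> t \<Longrightarrow> t \<le> T \<Longrightarrow> ref t \<in> A t"
  shows "running_loss f A X (\<lambda>t. x (ref t) t) T
    \<le> n_rms A T / n_mean A T * (2 * C * R * G * sqrt (3 * real \<tau> + 1) / sqrt (real T))"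
proof -
  interpret daeron V A f X x1 "\<lambda>i t. \<eta>" S M x g by fact
  define N where "N = (\<Sum>t=1..T. real (card (A t)))"
  define Q where "Q = n_rms A T"
  \<comment> \<open>With this abbreviation \<open>\<eta> = R\<^sub>0 / (Q G B)\<close>, and both error terms are multiples of \<open>R G B Q\<close>.\<close>
  define B where "B = sqrt ((3 * real \<tau> + 1) * real T)"
  have card_pos: "card (A t) > 0" if "t \<in> {1..T}" for t
    using that active_finite[of t] active_nonempty[of t] by (auto simp: card_gt_0_iff)
  have "N > 0"
    unfolding N_def using card_pos \<open>T \<ge> 1\<close> by (intro sum_pos) auto
  have sum_pos: "(\<Sum>t=1..T. (real (card (A t)))\<^sup>2) > 0"
    using card_pos \<open>T \<ge> 1\<close> by (intro sum_pos) auto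
  have sum_sq: "(\<Sum>t=1..T. (real (card (A t)))\<^sup>2) = real T * Q\<^sup>2"
    using sum_pos \<open>T \<ge> 1\<close> by (simp add: Q_def n_rms_def)
  have "Q > 0"
    using sum_pos \<open>T \<ge> 1\<close> by (simp add: Q_def n_rms_def)
  have "B > 0"
    using \<open>T \<ge> 1\<close> by (simp add: B_def)
  have B_sq: "B\<^sup>2 = (3 * real \<tau> + 1) * real T"
    by (simp add: B_def)
  have \<eta>_eq: "\<eta> = R\<^sub>0 / (Q * G * B)"
    using assms(14) by (simp add: Q_def B_def)
  have ustar: "ustar \<in> X"
    using assms(10) by (simp add: is_arg_min_def)
  have excess: "(\<Sum>t=1..T. \<Sum>i\<in>A t. f i (x (ref t) t)) - total_cost f A T ustar
      \<le> R\<^sup>2 / (2 * \<eta>) + \<eta> * G\<^sup>2 * (3 * real \<tau> + 1) * (real T * Q\<^sup>2)"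
    using total_cost_excess[where e = \<eta> and T = T and ref = ref,
        OF assms(3,5,6,4) ustar assms(9) refl assms(16)]
    unfolding sum_sq assms(11) .
  have "\<eta> * G\<^sup>2 * (3 * real \<tau> + 1) * (real T * Q\<^sup>2) = \<eta> * G\<^sup>2 * B\<^sup>2 * Q\<^sup>2"
    by (simp add: B_sq)
  also have "\<dots> = R\<^sub>0 / R * (R * G * B * Q)"
    using \<open>Q > 0\<close> \<open>B > 0\<close> \<open>G > 0\<close> \<open>R > 0\<close> by (simp add: \<eta>_eq field_simps power2_eq_square)
  also have "\<dots> \<le> C * (R * G * B * Q)"
    using \<open>Q > 0\<close> \<open>B > 0\<close> \<open>G > 0\<close> \<open>R > 0\<close> assms(15) by (intro mult_right_mono) auto
  finally have delay_term:
    "\<eta> * G\<^sup>2 * (3 * real \<tau> + 1) * (real T * Q\<^sup>2) \<le> C * (R * G * B * Q)" .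
  have "R\<^sup>2 / (2 * \<eta>) = R / (2 * R\<^sub>0) * (R * G * B * Q)"
    using \<open>Q > 0\<close> \<open>B > 0\<close> \<open>G > 0\<close> \<open>R\<^sub>0 > 0\<close> by (simp add: \<eta>_eq field_simps power2_eq_square)
  also have "\<dots> \<le> C * (R * G * B * Q)"
    using \<open>Q > 0\<close> \<open>B > 0\<close> \<open>G > 0\<close> \<open>R > 0\<close> assms(15) by (intro mult_right_mono) auto
  finally have "(\<Sum>t=1..T. \<Sum>i\<in>A t. f i (x (ref t) t)) - total_cost f A T ustar
      \<le> 2 * C * R * G * B * Q"
    using excess delay_term by (simp add: mult.assoc)
  then have "running_loss f A X (\<lambda>t. x (ref t) t) T \<le> 1 / N * (2 * C * R * G * B * Q)"
    unfolding running_loss_def INF_total_cost_minimizer[OF assms(10)] N_def of_nat_sum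
    using \<open>N > 0\<close> by (intro mult_left_mono) (auto simp: N_def)
  also have "\<dots> = Q / n_mean A T * (2 * C * R * G * sqrt (3 * real \<tau> + 1) / sqrt (real T))"
  proof -
    have N_eq: "N = sqrt (real T) * sqrt (real T) * n_mean A T"
      using \<open>T \<ge> 1\<close> by (simp add: n_mean_def N_def)
    have B_eq: "B = sqrt (3 * real \<tau> + 1) * sqrt (real T)"
      unfolding B_def by (rule real_sqrt_mult)
    show ?thesis
      unfolding N_eq B_eq using \<open>T \<ge> 1\<close> by (simp add: mult_ac del: real_sqrt_mult_self)
  qed
  finally show ?thesis
    by (simp add: Q_def)
qed

end
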